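(* Let $\tau$ be an infinite cardinal number and let $X$ be a space. Then the following conditions are equivalent: (a) $X$ is normal and $\tau$-paracompact. (b) If $Y$ is a completely metrizable space with $w(Y)\leq\tau$, $\Phi:X\to\mathscr{F}(Y)$ is l.s.c., $\theta:X\to\mathscr{C}(Y)$ is u.s.c. and $\theta<\Phi$, then there exists a u.s.c. mapping $\psi:X\to\mathscr{C}(Y)$ with $\theta<\psi\leqslant\Phi$.
   Context: All spaces are infinite Hausdorff topological spaces. For a set $Y$, $2^Y$ denotes the family of all nonempty subsets of $Y$. For a space $Y$: $\mathscr{F}(Y)$ and $\mathscr{C}(Y)$ are the families of all nonempty closed, respectively nonempty compact, subsets of $Y$; $w(Y)$ is the topological weight of $Y$. A mapping $\Phi:X\to 2^Y$ is l.s.c. if $\{x\in X:\Phi(x)\cap U\neq\varnothing\}$ is open for every open $U\subseteq Y$; u.s.c. if $\{x\in X:\Phi(x)\cap F\neq\varnothing\}$ is closed for every closed $F\subseteq Y$. For $\theta,\Phi:X\to 2^Y$, $\theta\leqslant\Phi$ means $\theta(x)\subseteq\Phi(x)$ for all $x\in X$; $\theta<\Phi$ means $\theta\leqslant\Phi$ and $\Phi(x)\setminus\theta(x)\neq\varnothing$ for all $x\in X$. A space $X$ is $\tau$-paracompact if each open cover of $X$ of cardinality $\leq\tau$ has a locally finite open refinement (covering $X$). *)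

theory Defs
  imports "HOL-Analysis.Analysis"
begin

unbundle cardinal_syntax

definition topology_base :: "'a topology \<Rightarrow> 'a set set \<Rightarrow> bool" where
  "topology_base X \<B> \<longleftrightarrow>
     (\<forall>V \<in> \<B>. openin X V) \<and>
     (\<forall>U x. openin X U \<and> x \<in> U \<longrightarrow> (\<exists>V \<in> \<B>. x \<in> V \<and> V \<subseteq> U))"

text \<open>
  The weight is the least cardinality of a base, represented by the cardinal order
  of some base of minimal cardinality. The lemmas below show that such a base exists and
  that the choice does not affect comparisons with other cardinals.
\<close>

definition weight :: "'a topology \<Rightarrow> 'a set rel" where
  "weight X =
     |SOME \<B>. topology_base X \<B> \<and> (\<forall>\<B>'. topology_base X \<B>' \<longrightarrow> |\<B>| \<le>o |\<B>'| )|"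

lemma weight_base:
  "\<exists>\<B>. topology_base X \<B> \<and> weight X = |\<B>| \<and>
       (\<forall>\<B>'. topology_base X \<B>' \<longrightarrow> |\<B>| \<le>o |\<B>'| )"
proof -
  let ?R = "card_of ` {\<B>. topology_base X \<B>}"
  have "topology_base X {U. openin X U}"
    unfolding topology_base_def by blast
  then have "?R \<noteq> {}" by blast
  moreover have "\<forall>r \<in> ?R. Well_order r"
    using card_of_Well_order by blast
  ultimately have "\<exists>r \<in> ?R. \<forall>r' \<in> ?R. r \<le>o r'"
    by (rule exists_minim_Well_order)
  then have "\<exists>\<B>. topology_base X \<B> \<and> (\<forall>\<B>'. topology_base X \<B>' \<longrightarrow> |\<B>| \<le>o |\<B>'| )"
    by blast
  from someI_ex[OF this] show ?thesis
    unfolding weight_def by blast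
qed

lemma weight_ordLeq_iff:
  "weight X \<le>o \<tau> \<longleftrightarrow> (\<exists>\<B>. topology_base X \<B> \<and> |\<B>| \<le>o \<tau>)"
  using weight_base[of X] by (metis ordLeq_transitive)

text \<open>A cover of cardinality at most \<open>\<tau>\<close> is a set of open sets, not an indexed family.\<close>

definition tau_paracompact :: "'k rel \<Rightarrow> 'a topology \<Rightarrow> bool" where
  "tau_paracompact \<tau> X \<longleftrightarrow>
     (\<forall>\<U>. (\<forall>U \<in> \<U>. openin X U) \<and> \<Union>\<U> = topspace X \<and> |\<U>| \<le>o \<tau> \<longrightarrow>
       (\<exists>\<V>. (\<forall>V \<in> \<V>. openin X V) \<and> \<Union>\<V> = topspace X \<and>
            (\<forall>V \<in> \<V>. \<exists>U \<in> \<U>. V \<subseteq> U) \<and> locally_finite_in X \<V>))"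

definition nonempty_closed_sets :: "'b topology \<Rightarrow> 'b set set" where
  "nonempty_closed_sets Y = {S. closedin Y S \<and> S \<noteq> {}}"

definition nonempty_compact_sets :: "'b topology \<Rightarrow> 'b set set" where
  "nonempty_compact_sets Y = {S. compactin Y S \<and> S \<noteq> {}}"

text \<open>
  A set-valued mapping on the space \<open>X\<close> is a HOL function of which only the values on
  \<open>topspace X\<close> matter.
\<close>

definition lsc :: "'a topology \<Rightarrow> 'b topology \<Rightarrow> ('a \<Rightarrow> 'b set) \<Rightarrow> bool" where
  "lsc X Y \<Phi> \<longleftrightarrow> (\<forall>U. openin Y U \<longrightarrow> openin X {x \<in> topspace X. \<Phi> x \<inter> U \<noteq> {}})"

definition usc :: "'a topology \<Rightarrow> 'b topology \<Rightarrow> ('a \<Rightarrow> 'b set) \<Rightarrow> bool" where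
  "usc X Y \<Phi> \<longleftrightarrow> (\<forall>F. closedin Y F \<longrightarrow> closedin X {x \<in> topspace X. \<Phi> x \<inter> F \<noteq> {}})"

definition svm_le :: "'a topology \<Rightarrow> ('a \<Rightarrow> 'b set) \<Rightarrow> ('a \<Rightarrow> 'b set) \<Rightarrow> bool" where
  "svm_le X \<theta> \<Phi> \<longleftrightarrow> (\<forall>x \<in> topspace X. \<theta> x \<subseteq> \<Phi> x)"

definition svm_less :: "'a topology \<Rightarrow> ('a \<Rightarrow> 'b set) \<Rightarrow> ('a \<Rightarrow> 'b set) \<Rightarrow> bool" where
  "svm_less X \<theta> \<Phi> \<longleftrightarrow> svm_le X \<theta> \<Phi> \<and> (\<forall>x \<in> topspace X. \<Phi> x - \<theta> x \<noteq> {})"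

text \<open>
  The extension property for all infinite completely metrizable spaces \<open>Y\<close> of weight at most
  \<open>\<tau>\<close> whose points are taken from the type \<open>'b\<close>. The type argument is needed because a
  formula of HOL cannot quantify over types. A metrizable space of weight at most \<open>\<tau>\<close> has
  at most \<open>\<tau>\<close> to the power \<open>\<aleph>\<^sub>0\<close> points, so if \<open>\<tau>\<close> is an infinite
  cardinal on \<open>'k\<close>, then the type \<open>nat \<Rightarrow> 'k\<close> carries a homeomorphic copy of
  every such space.
\<close>

definition strict_usc_extension :: "'k rel \<Rightarrow> 'a topology \<Rightarrow> 'b itself \<Rightarrow> bool" where
  "strict_usc_extension \<tau> X (T :: 'b itself) \<longleftrightarrow>
     (\<forall>(Y :: 'b topology) \<Phi> \<theta>.
        infinite (topspace Y) \<and> completely_metrizable_space Y \<and> weight Y \<le>o \<tau> \<and>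
        \<Phi> \<in> topspace X \<rightarrow> nonempty_closed_sets Y \<and> lsc X Y \<Phi> \<and>
        \<theta> \<in> topspace X \<rightarrow> nonempty_compact_sets Y \<and> usc X Y \<theta> \<and>
        svm_less X \<theta> \<Phi> \<longrightarrow>
        (\<exists>\<psi>. \<psi> \<in> topspace X \<rightarrow> nonempty_compact_sets Y \<and> usc X Y \<psi> \<and>
             svm_less X \<theta> \<psi> \<and> svm_le X \<psi> \<Phi>))"

end

theory Submission
  imports Defs
begin

text \<open>
  For the extension property, every point \<open>x\<close> has a neighbourhood on which \<open>\<theta>\<close> stays inside an
  open set \<open>\<Union>\<F>\<close> while \<open>\<Phi>\<close> meets a basic open set \<open>B\<close> whose closure misses \<open>\<Union>\<F>\<close>. Normality and
  \<open>\<tau>\<close>-paracompactness turn these at most \<open>\<tau>\<close> neighbourhoods into a locally finite closed cover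
  \<open>E\<close>. On each member of \<open>E\<close>, Michael's theorem yields a u.s.c. compact-valued selection of the
  closure of \<open>\<Phi> x \<inter> B\<close>, and \<open>\<psi>\<close> is the union of \<open>\<theta>\<close> with these selections.

  Conversely, an open cover of size at most \<open>\<tau>\<close> defines an l.s.c. mapping into a discrete space
  that sends a point to the members containing it; a u.s.c. finite-valued mapping below it is a
  locally finite closed refinement. Two-element covers give normality.
\<close>

section \<open>Locally finite families and shrinkings in normal spaces\<close>

text \<open>Indices are counted here, not sets as in \<open>locally_finite_in\<close>: a member
  containing a given point may recur only finitely often, while empty members are free. Families can
  thus be indexed by a whole type and padded with empty sets.\<close>

definition locally_finite_family :: "'a topology \<Rightarrow> ('i \<Rightarrow> 'a set) \<Rightarrow> bool" where
  "locally_finite_family X A \<longleftrightarrow>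
     (\<forall>x \<in> topspace X. \<exists>N. openin X N \<and> x \<in> N \<and> finite {i. A i \<inter> N \<noteq> {}})"

lemma closedin_UN_locally_finite_family:
  assumes "locally_finite_family X A" and "\<And>i. closedin X (A i)"
  shows "closedin X (\<Union>i\<in>I. A i)"
proof (rule closedin_locally_finite_Union)
  show "closedin X S" if "S \<in> A ` I" for S
    using that assms(2) by blast
  show "locally_finite_in X (A ` I)"
    unfolding locally_finite_in_def
  proof (intro conjI ballI)
    show "\<Union>(A ` I) \<subseteq> topspace X"
      using assms(2) closedin_subset by blast
    fix x assume "x \<in> topspace X"
    then obtain N where N: "openin X N" "x \<in> N" "finite {i. A i \<inter> N \<noteq> {}}"
      using assms(1) unfolding locally_finite_family_def by blast
    have "{U \<in> A ` I. U \<inter> N \<noteq> {}} \<subseteq> A ` {i. A i \<inter> N \<noteq> {}}"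
      by blast
    with N show "\<exists>V. openin X V \<and> x \<in> V \<and> finite {U \<in> A ` I. U \<inter> V \<noteq> {}}"
      using finite_surj by blast
  qed
qed

lemma locally_finite_family_mono:
  assumes "locally_finite_family X A" and "\<And>i. B i \<subseteq> A i"
  shows "locally_finite_family X B"
  unfolding locally_finite_family_def
proof
  fix x assume "x \<in> topspace X"
  then obtain N where N: "openin X N" "x \<in> N" "finite {i. A i \<inter> N \<noteq> {}}"
    using assms(1) unfolding locally_finite_family_def by blast
  have "{i. B i \<inter> N \<noteq> {}} \<subseteq> {i. A i \<inter> N \<noteq> {}}"
    using assms(2) by blast
  with N show "\<exists>N. openin X N \<and> x \<in> N \<and> finite {i. B i \<inter> N \<noteq> {}}"
    using finite_subset by blast
qed

lemma locally_finite_family_finite: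
  assumes "locally_finite_family X A" and "x \<in> topspace X"
  shows "finite {i. x \<in> A i}"
proof -
  obtain N where "openin X N" "x \<in> N" "finite {i. A i \<inter> N \<noteq> {}}"
    using assms unfolding locally_finite_family_def by blast
  then show ?thesis
    by (elim rev_finite_subset) blast
qed

text \<open>
  The closed sets are chosen by well-founded recursion on the index: the \<open>i\<close>-th one contains
  every point not covered by the interiors chosen before \<open>i\<close> and the sets \<open>V j\<close> with
  \<open>j\<close> after \<open>i\<close>. Point-finiteness provides the last index whose set contains a given point.
\<close>

lemma normal_space_shrinking:
  fixes V :: "'i \<Rightarrow> 'a set"
  assumes "normal_space X" and V: "\<And>i. openin X (V i)" and cover: "topspace X \<subseteq> (\<Union>i. V i)"
    and pf: "\<And>x. x \<in> topspace X \<Longrightarrow> finite {i. x \<in> V i}"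
  obtains E where "\<And>i. closedin X (E i)" "\<And>i. E i \<subseteq> V i" "topspace X = (\<Union>i. E i)"
proof -
  obtain r :: "'i rel" where r: "well_order_on UNIV r"
    using Zorn.well_order_on by blast
  define R where "R = r - Id"
  have "wf R" "trans R"
    using r unfolding R_def well_order_on_def linear_order_on_def partial_order_on_def preorder_on_def
    by (auto simp: trans_diff_Id)
  have R_total: "(i, j) \<in> R \<or> i = j \<or> (j, i) \<in> R" for i j
    using r unfolding R_def well_order_on_def linear_order_on_def total_on_def by blast
  define C where "C g i = topspace X - (\<Union>j\<in>{j. (j, i) \<in> R}. g j) - (\<Union>j\<in>{j. (i, j) \<in> R}. V j)" for g i
  define Q where "Q g i H \<longleftrightarrow> openin X H \<and> C g i \<subseteq> H \<and> X closure_of H \<subseteq> V i" for g i H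
  define G where "G = wfrec R (\<lambda>g i. SOME H. Q g i H)"
  have G_eq: "G i = (SOME H. Q G i H)" for i
  proof -
    \<comment> \<open>\<open>C g i\<close> consults \<open>g\<close> only at predecessors of
      \<open>i\<close>, so replacing \<open>G\<close> by its restriction to them changes
      nothing.\<close>
    have "C (cut G R i) i = C G i"
      unfolding C_def by (simp add: cut_apply)
    then have "Q (cut G R i) i = Q G i"
      unfolding Q_def by metis
    moreover have "G i = (SOME H. Q (cut G R i) i H)"
      unfolding G_def using wfrec[OF \<open>wf R\<close>] by metis
    ultimately show ?thesis by simp
  qed
  have last: "\<exists>j. x \<in> V j \<and> (\<forall>k. (j, k) \<in> R \<longrightarrow> x \<notin> V k)" if "x \<in> topspace X" for x
  proof -
    have "finite {i. x \<in> V i}" "{i. x \<in> V i} \<noteq> {}"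
      using pf cover that by blast+
    moreover have "irrefl R"
      unfolding R_def irrefl_def by blast
    ultimately have "\<exists>j\<in>{i. x \<in> V i}. \<forall>k\<in>{i. x \<in> V i}. k \<noteq> j \<longrightarrow> (j, k) \<notin> R"
      using \<open>trans R\<close>
      by (intro Finite_Set.bex_max_element asymp_onI transp_onI) (auto simp: irrefl_def dest: transD)
    with \<open>irrefl R\<close> show ?thesis
      unfolding irrefl_def by (metis mem_Collect_eq)
  qed
  have C_iff: "x \<in> C g i \<longleftrightarrow>
      x \<in> topspace X \<and> (\<forall>j. (j, i) \<in> R \<longrightarrow> x \<notin> g j) \<and> (\<forall>j. (i, j) \<in> R \<longrightarrow> x \<notin> V j)" for x g i
    unfolding C_def by auto
  have Q: "Q G i (G i)" for i
    using \<open>wf R\<close>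
  proof (induction i)
    case (less i)
    have "C G i \<subseteq> V i"
    proof
      fix x assume x: "x \<in> C G i"
      then have "x \<in> topspace X"
        by (simp add: C_iff)
      from last[OF this] obtain j where j: "x \<in> V j" "\<And>k. (j, k) \<in> R \<Longrightarrow> x \<notin> V k"
        by blast
      show "x \<in> V i"
      \<comment> \<open>\<open>C G i\<close> excludes every later \<open>V j\<close>, so the last
        index \<open>j\<close> of \<open>x\<close> would precede \<open>i\<close>. Then
        \<open>x\<close> lies in \<open>C G j\<close>, hence in \<open>G j\<close> by induction, and
        \<open>C G i\<close> excludes \<open>G j\<close> too.\<close>
      proof (rule ccontr)
        assume "x \<notin> V i"
        then have ji: "(j, i) \<in> R"
          using R_total[of i j] j(1) x by (auto simp: C_iff)
        then have "x \<in> C G j" "x \<notin> G j"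
          using x j(2) transD[OF \<open>trans R\<close>] by (auto simp: C_iff)
        then show False
          using less[OF ji] unfolding Q_def by blast
      qed
    qed
    moreover have "closedin X (C G i)"
    proof -
      have "openin X (\<Union>j\<in>{j. (j, i) \<in> R}. G j)"
        using less unfolding Q_def by (intro openin_Union) auto
      moreover have "openin X (\<Union>j\<in>{j. (i, j) \<in> R}. V j)"
        using V by (intro openin_Union) auto
      ultimately show ?thesis
        unfolding C_def by (intro closedin_diff) auto
    qed
    ultimately have "\<exists>H. openin X H \<and> C G i \<subseteq> H \<and> X closure_of H \<subseteq> V i"
      using \<open>normal_space X\<close> V[of i] unfolding normal_space_alt by simp
    then have "\<exists>H. Q G i H"
      unfolding Q_def .
    then show ?case
      unfolding G_eq[of i] by (rule someI_ex)
  qed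
  have subset: "G i \<subseteq> X closure_of G i" for i
    using Q[of i] unfolding Q_def by (simp add: closure_of_subset openin_subset)
  show ?thesis
  proof
    show "closedin X (X closure_of G i)" "X closure_of G i \<subseteq> V i" for i
      using Q[of i] unfolding Q_def by auto
    have "x \<in> (\<Union>i. X closure_of G i)" if x: "x \<in> topspace X" for x
    proof -
      obtain j where j: "x \<in> V j" "\<And>k. (j, k) \<in> R \<Longrightarrow> x \<notin> V k"
        using last[OF x] by blast
      have "\<exists>i. x \<in> G i"
      \<comment> \<open>No set after \<open>j\<close> contains \<open>x\<close>, so failing to be in
        \<open>C G j\<close> means lying in an earlier \<open>G\<close>.\<close>
      proof (cases "x \<in> C G j")
        case True
        then show ?thesis using Q[of j] unfolding Q_def by blast
      next
        case False
        then show ?thesis using x j(2) by (auto simp: C_iff)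
      qed
      then show ?thesis
        using subset by blast
    qed
    then show "topspace X = (\<Union>i. X closure_of G i)"
      using closure_of_subset_topspace by fastforce
  qed
qed

section \<open>Cardinality of the family of finite subsets\<close>

lemma finite_ordLeq_infinite_Card_order:
  assumes "finite A" and "Card_order \<tau>" and "infinite (Field \<tau>)"
  shows "|A| \<le>o \<tau>"
proof -
  have "|A| <o |Field \<tau>|"
    using assms(1,3) by (intro finite_ordLess_infinite card_of_Well_order) (auto simp: Field_card_of)
  then show ?thesis
    using assms(2) card_of_Field_ordIso ordLess_imp_ordLeq ordLeq_ordIso_trans by blast
qed

text \<open>A set of size \<open>n + 1\<close> arises by inserting an element of \<open>A\<close>
  into one of size \<open>n\<close>, so induction bounds each \<open>P n\<close>, and there are
  countably many \<open>n\<close>. This keeps covers whose indices involve finite subfamilies within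
  size \<open>\<tau>\<close>.\<close>

lemma Fpow_ordLeq_infinite_Card_order:
  assumes "|A| \<le>o \<tau>" and \<tau>: "Card_order \<tau>" "infinite (Field \<tau>)"
  shows "|Fpow A| \<le>o \<tau>"
proof -
  define P where "P n = {S \<in> Fpow A. card S = n}" for n
  have "|P n| \<le>o \<tau>" for n
  proof (induction n)
    case 0
    have "P 0 \<subseteq> {{}}"
      unfolding P_def Fpow_def by auto
    then show ?case
      using finite_ordLeq_infinite_Card_order \<tau> finite_subset by blast
  next
    case (Suc n)
    have "P (Suc n) \<subseteq> (\<lambda>(a, S). insert a S) ` (A \<times> P n)"
    proof
      fix S assume "S \<in> P (Suc n)"
      then have S: "S \<subseteq> A" "finite S" "card S = Suc n"
        unfolding P_def Fpow_def by auto
      then obtain a T where "S = insert a T" "a \<notin> T" "card T = n"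
        by (metis card_Suc_eq)
      then show "S \<in> (\<lambda>(a, S). insert a S) ` (A \<times> P n)"
        using S unfolding P_def Fpow_def by (intro image_eqI[of _ _ "(a, T)"]) auto
    qed
    then have "|P (Suc n)| \<le>o |A \<times> P n|"
      using card_of_mono1 card_of_image ordLeq_transitive by blast
    moreover have "|A \<times> P n| \<le>o \<tau>"
      using assms Suc by (intro card_of_Times_ordLeq_infinite_Field) auto
    ultimately show ?case
      by (rule ordLeq_transitive)
  qed
  moreover have "|UNIV :: nat set| \<le>o \<tau>"
    using \<tau> infinite_iff_card_of_nat card_of_Field_ordIso ordLeq_ordIso_trans by blast
  ultimately have "|\<Union>n. P n| \<le>o \<tau>"
    using \<tau> by (intro card_of_UNION_ordLeq_infinite_Field) auto
  moreover have "Fpow A = (\<Union>n. P n)"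
    unfolding P_def by auto
  ultimately show ?thesis by simp
qed

section \<open>Locally finite closed refinements and closed sieves\<close>

text \<open>Adding the complement of \<open>F\<close> to the \<open>W i\<close> gives an open cover
  of \<open>X\<close>. Its locally finite open refinement shrinks to closed sets, whose traces on
  \<open>F\<close> are grouped by a chosen \<open>W i\<close>, so that the groups carry the original
  indices.\<close>

lemma tau_paracompact_closed_refinement:
  fixes W :: "'i \<Rightarrow> 'a set"
  assumes \<tau>: "Card_order \<tau>" "infinite (Field \<tau>)" and X: "normal_space X" "tau_paracompact \<tau> X"
    and I: "|I| \<le>o \<tau>" and W: "\<And>i. i \<in> I \<Longrightarrow> openin X (W i)"
    and F: "closedin X F" "F \<subseteq> (\<Union>i\<in>I. W i)"
  obtains E where "\<And>i. closedin X (E i)" "\<And>i. E i \<subseteq> W i" "F = (\<Union>i. E i)"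
    "\<And>i. i \<notin> I \<Longrightarrow> E i = {}" "locally_finite_family X E"
proof -
  let ?\<U> = "insert (topspace X - F) (W ` I)"
  have "|{topspace X - F} \<union> W ` I| \<le>o \<tau>"
    using \<tau> finite_ordLeq_infinite_Card_order[OF _ \<tau>, of "{topspace X - F}"]
      ordLeq_transitive[OF card_of_image I] by (intro card_of_Un_ordLeq_infinite_Field) auto
  moreover have "\<forall>U\<in>?\<U>. openin X U"
    using W F by blast
  moreover have "\<Union>?\<U> = topspace X"
  proof
    show "\<Union>?\<U> \<subseteq> topspace X"
      using W openin_subset by blast
    show "topspace X \<subseteq> \<Union>?\<U>"
      using F(2) by blast
  qed
  ultimately obtain \<V> where \<V>: "\<And>V. V \<in> \<V> \<Longrightarrow> openin X V" "\<Union>\<V> = topspace X"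
      "\<And>V. V \<in> \<V> \<Longrightarrow> \<exists>U\<in>?\<U>. V \<subseteq> U" "locally_finite_in X \<V>"
    using X(2) unfolding tau_paracompact_def by (metis (no_types, lifting) insert_is_Un)
  \<comment> \<open>Each set is its own index, with empty value outside \<open>\<V>\<close>; this
    turns a set of sets into a family over a whole type.\<close>
  define V where "V S = (if S \<in> \<V> then S else {})" for S
  have lf: "locally_finite_family X V"
    unfolding locally_finite_family_def
  proof
    fix x assume "x \<in> topspace X"
    then obtain N where N: "openin X N" "x \<in> N" "finite {S\<in>\<V>. S \<inter> N \<noteq> {}}"
      using \<V>(4) unfolding locally_finite_in_def by blast
    moreover have "{S. V S \<inter> N \<noteq> {}} = {S\<in>\<V>. S \<inter> N \<noteq> {}}"
      unfolding V_def by auto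
    ultimately show "\<exists>N. openin X N \<and> x \<in> N \<and> finite {S. V S \<inter> N \<noteq> {}}"
      by auto
  qed
  have "openin X (V S)" for S
    using \<V>(1) unfolding V_def by auto
  moreover have "topspace X \<subseteq> (\<Union>S. V S)"
    using \<V>(2) unfolding V_def by force
  ultimately obtain E where E: "\<And>S. closedin X (E S)" "\<And>S. E S \<subseteq> V S" "topspace X = (\<Union>S. E S)"
    using normal_space_shrinking[OF X(1), of V] locally_finite_family_finite[OF lf] by metis
  have lfE: "locally_finite_family X (\<lambda>S. F \<inter> E S)"
    using lf by (rule locally_finite_family_mono) (use E in blast)
  \<comment> \<open>Members of \<open>\<V>\<close> inside the complement of \<open>F\<close> leave
    no trace on \<open>F\<close> and need no index; every other member lies in some
    \<open>W i\<close>.\<close>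
  have "\<exists>i\<in>I. S \<subseteq> W i" if "S \<in> \<V>" "\<not> S \<subseteq> topspace X - F" for S
    using \<V>(3)[OF that(1)] that(2) by blast
  then obtain c where c: "\<And>S. S \<in> \<V> \<Longrightarrow> \<not> S \<subseteq> topspace X - F \<Longrightarrow> c S \<in> I \<and> S \<subseteq> W (c S)"
    by metis
  define J where "J i = {S \<in> \<V>. \<not> S \<subseteq> topspace X - F \<and> c S = i}" for i
  show ?thesis
  proof
    show "closedin X (\<Union>S\<in>J i. F \<inter> E S)" for i
      using lfE by (rule closedin_UN_locally_finite_family) (use E F in blast)
    show "(\<Union>S\<in>J i. F \<inter> E S) \<subseteq> W i" for i
      using c E(2) unfolding J_def V_def by fastforce
    show "(\<Union>S\<in>J i. F \<inter> E S) = {}" if "i \<notin> I" for i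
      using c that unfolding J_def by auto
    show "F = (\<Union>i. \<Union>S\<in>J i. F \<inter> E S)"
    proof
      show "F \<subseteq> (\<Union>i. \<Union>S\<in>J i. F \<inter> E S)"
      proof
        fix x assume x: "x \<in> F"
        then have "x \<in> (\<Union>S. E S)"
          using F(1)[THEN closedin_subset] unfolding E(3) by (rule rev_subsetD)
        then obtain S where S: "x \<in> E S"
          by (rule UN_E)
        then have "S \<in> J (c S)"
          using E(2)[of S] x unfolding J_def V_def by (auto split: if_splits)
        then show "x \<in> (\<Union>i. \<Union>S\<in>J i. F \<inter> E S)"
          using x S by blast
      qed
      show "(\<Union>i. \<Union>S\<in>J i. F \<inter> E S) \<subseteq> F"
        by (intro UN_least Int_lower1)
    qed
    show "locally_finite_family X (\<lambda>i. \<Union>S\<in>J i. F \<inter> E S)"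
      unfolding locally_finite_family_def
    proof
      fix x assume "x \<in> topspace X"
      then obtain N where N: "openin X N" "x \<in> N" "finite {S. F \<inter> E S \<inter> N \<noteq> {}}"
        using lfE unfolding locally_finite_family_def by blast
      \<comment> \<open>A group meeting \<open>N\<close> contains a trace meeting \<open>N\<close>,
        and only finitely many traces do.\<close>
      have "{i. (\<Union>S\<in>J i. F \<inter> E S) \<inter> N \<noteq> {}} \<subseteq> c ` {S. F \<inter> E S \<inter> N \<noteq> {}}"
        unfolding J_def by blast
      then have "finite {i. (\<Union>S\<in>J i. F \<inter> E S) \<inter> N \<noteq> {}}"
        by (rule finite_surj[OF N(3)])
      with N show "\<exists>N. openin X N \<and> x \<in> N \<and> finite {i. (\<Union>S\<in>J i. F \<inter> E S) \<inter> N \<noteq> {}}"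
        by blast
    qed
  qed
qed

text \<open>
  Lists serve as nodes of a tree with the newest element at the head, so \<open>s\<close> is the parent
  of \<open>i # s\<close>.
\<close>

lemma tau_paracompact_closed_sieve:
  fixes W :: "'i list \<Rightarrow> 'a set"
  assumes \<tau>: "Card_order \<tau>" "infinite (Field \<tau>)" and X: "normal_space X" "tau_paracompact \<tau> X"
    and I: "|I| \<le>o \<tau>" and W: "\<And>s. openin X (W s)" "topspace X \<subseteq> W []"
    and split: "\<And>s. W s \<subseteq> (\<Union>i\<in>I. W (i # s))"
  obtains F where "\<And>s. closedin X (F s)" "\<And>s. F s \<subseteq> W s" "F [] = topspace X"
    "\<And>s. F s = (\<Union>i. F (i # s))"
    "\<And>n. locally_finite_family X (\<lambda>s. if length s = n then F s else {})"
proof -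
  define P where "P s A E \<longleftrightarrow> (\<forall>i. closedin X (E i) \<and> E i \<subseteq> W (i # s)) \<and> A = (\<Union>i. E i) \<and>
      locally_finite_family X E" for s A E
  have P_D: "closedin X (E i) \<and> E i \<subseteq> W (i # s)" if "P s A E" for s A E i
    using that unfolding P_def by blast
  have P_ex: "\<exists>E. P s A E" if A: "closedin X A" "A \<subseteq> W s" for s A
  proof -
    have cov: "A \<subseteq> (\<Union>i\<in>I. W (i # s))"
      using A(2) split[of s] by (rule subset_trans)
    show ?thesis
    proof (rule tau_paracompact_closed_refinement[where W = "\<lambda>i. W (i # s)", OF \<tau> X I W(1) A(1) cov])
      fix E :: "'i \<Rightarrow> 'a set"
      assume "\<And>i. closedin X (E i)" "\<And>i. E i \<subseteq> W (i # s)" "A = (\<Union>i. E i)"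
        "locally_finite_family X E"
      then show ?thesis
        unfolding P_def by blast
    qed
  qed
  \<comment> \<open>The splitting is chosen once for the node \<open>s\<close> and its value
    \<open>A\<close>, independently of \<open>i\<close>, so all children of \<open>s\<close> are
    pieces of the same splitting.\<close>
  define F where "F = rec_list (topspace X) (\<lambda>i s A. (SOME E. P s A E) i)"
  have F_Nil: "F [] = topspace X" and F_Cons: "F (i # s) = (SOME E. P s (F s) E) i" for i s
    unfolding F_def by simp_all
  have F_closed: "closedin X (F s) \<and> F s \<subseteq> W s" for s
  proof (induction s)
    case Nil
    then show ?case using W by (simp add: F_Nil)
  next
    case (Cons i s)
    then have "\<exists>E. P s (F s) E"
      using P_ex by blast
    then have "P s (F s) (SOME E. P s (F s) E)"
      by (rule someI_ex)
    then show ?case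
      unfolding F_Cons by (rule P_D)
  qed
  then have "\<exists>E. P s (F s) E" for s
    using P_ex by blast
  then have "P s (F s) (SOME E. P s (F s) E)" for s
    by (rule someI_ex)
  then have P: "P s (F s) (\<lambda>i. F (i # s))" for s
    unfolding F_Cons .
  show ?thesis
  proof
    show "closedin X (F s)" "F s \<subseteq> W s" for s
      using F_closed by blast+
    show "F [] = topspace X"
      by (fact F_Nil)
    show F_UN: "F s = (\<Union>i. F (i # s))" for s
      using P unfolding P_def by blast
    show "locally_finite_family X (\<lambda>s. if length s = n then F s else {})" for n
    proof (induction n)
      case 0
      have "finite {s. (if length s = 0 then F s else {}) \<inter> topspace X \<noteq> {}}"
        by (rule finite_subset[of _ "{[]}"]) (auto split: if_splits)
      then show ?case
        unfolding locally_finite_family_def by (meson openin_topspace)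
    next
      case (Suc n)
      show ?case
        unfolding locally_finite_family_def
      proof
        fix x assume x: "x \<in> topspace X"
        then obtain N where N: "openin X N" "x \<in> N"
            "finite {s. (if length s = n then F s else {}) \<inter> N \<noteq> {}}"
          using Suc unfolding locally_finite_family_def by blast
        define T where "T = {s. length s = n \<and> F s \<inter> N \<noteq> {}}"
        have "T = {s. (if length s = n then F s else {}) \<inter> N \<noteq> {}}"
          unfolding T_def by auto
        then have "finite T"
          using N(3) by metis
        have "\<exists>N. openin X N \<and> x \<in> N \<and> finite {i. F (i # s) \<inter> N \<noteq> {}}" for s
          using P x unfolding P_def locally_finite_family_def by blast
        then obtain N' where N': "\<And>s. openin X (N' s)" "\<And>s. x \<in> N' s"
            "\<And>s. finite {i. F (i # s) \<inter> N' s \<noteq> {}}"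
          by metis
        \<comment> \<open>Only nodes in the finite set \<open>T\<close> can have children meeting
          \<open>N\<close>, and inside \<open>N' s\<close> only finitely many children of
          \<open>s\<close> remain. The factor \<open>topspace X\<close> keeps the set open when
          \<open>T\<close> is empty and the intersection over it is \<open>UNIV\<close>.\<close>
        let ?N = "N \<inter> (topspace X \<inter> \<Inter>(N' ` T))"
        have "openin X (topspace X \<inter> \<Inter>(N' ` T))"
          using \<open>finite T\<close> N'(1) by (cases "T = {}") (auto intro!: openin_Int openin_Inter)
        then have "openin X ?N" "x \<in> ?N"
          using N N' x by (auto intro: openin_Int)
        moreover have "{t. (if length t = Suc n then F t else {}) \<inter> ?N \<noteq> {}} \<subseteq>
            (\<Union>s\<in>T. (\<lambda>i. i # s) ` {i. F (i # s) \<inter> N' s \<noteq> {}})"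
        proof
          fix t assume "t \<in> {t. (if length t = Suc n then F t else {}) \<inter> ?N \<noteq> {}}"
          then have t: "length t = Suc n" "F t \<inter> ?N \<noteq> {}"
            by (auto split: if_splits)
          then obtain i s where it: "t = i # s" "length s = n"
            by (auto simp: length_Suc_conv)
          then have "s \<in> T"
            using t F_UN[of s] unfolding T_def by blast
          then show "t \<in> (\<Union>s\<in>T. (\<lambda>i. i # s) ` {i. F (i # s) \<inter> N' s \<noteq> {}})"
            using t it by blast
        qed
        then have "finite {t. (if length t = Suc n then F t else {}) \<inter> ?N \<noteq> {}}"
          using \<open>finite T\<close> N'(3) by (elim finite_subset) blast
        ultimately show "\<exists>N. openin X N \<and> x \<in> N \<and>
            finite {s. (if length s = Suc n then F s else {}) \<inter> N \<noteq> {}}"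
          by blast
      qed
    qed
  qed
qed

section \<open>Decreasing closed sets in complete metric spaces\<close>

context Metric_space
begin

text \<open>From index \<open>n\<close> on the sequence stays in \<open>C n\<close>, which finitely
  many small balls cover, and the first \<open>n\<close> terms are only finitely many. So the range
  is totally bounded, completeness gives a limit of a subsequence, and its tails put the limit into
  every closed \<open>C n\<close>.\<close>

lemma closed_decseq_convergent_subsequence:
  assumes "mcomplete" and C: "\<And>n. closedin mtopology (C n)" "decseq C"
    and small: "\<forall>\<epsilon>>0. \<exists>n K. finite K \<and> C n \<subseteq> (\<Union>a\<in>K. mcball a \<epsilon>)"
    and y: "\<And>n. y n \<in> C n"
  shows "\<exists>l r. strict_mono (r :: nat \<Rightarrow> nat) \<and> limitin mtopology (y \<circ> r) l sequentially \<and> (\<forall>n. l \<in> C n)"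
proof -
  have yM: "y n \<in> M" for n
    using closedin_subset[OF C(1)] y by auto
  have "mtotally_bounded (range y)"
    unfolding mtotally_bounded_def
  proof (intro allI impI)
    fix \<epsilon> :: real assume "\<epsilon> > 0"
    then obtain n K where K: "finite K" "C n \<subseteq> (\<Union>a\<in>K. mcball a (\<epsilon> / 3))"
      using small[rule_format, of "\<epsilon> / 3"] by auto
    \<comment> \<open>Total boundedness asks for centres in \<open>range y\<close>, so each ball
      that meets the sequence is recentred at a term; radius \<open>\<epsilon> / 3\<close> leaves
      room for the detour through the old centre.\<close>
    have "\<forall>a. \<exists>z. (\<exists>k. y k \<in> mcball a (\<epsilon> / 3)) \<longrightarrow> z \<in> range y \<and> z \<in> mcball a (\<epsilon> / 3)"
      by blast
    then obtain z where z: "\<And>a k. y k \<in> mcball a (\<epsilon> / 3) \<Longrightarrow> z a \<in> range y \<and> z a \<in> mcball a (\<epsilon> / 3)"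
      by metis
    let ?K = "y ` {..<n} \<union> z ` {a \<in> K. \<exists>k. y k \<in> mcball a (\<epsilon> / 3)}"
    have "y k \<in> (\<Union>x\<in>?K. mball x \<epsilon>)" for k
    proof (cases "k < n")
      case True
      moreover have "y k \<in> mball (y k) \<epsilon>"
        using yM \<open>\<epsilon> > 0\<close> by simp
      ultimately show ?thesis by blast
    next
      case False
      then have "C k \<subseteq> C n"
        using decseqD[OF C(2)] by simp
      then have "y k \<in> C n"
        using y by blast
      then obtain a where a: "a \<in> K" "y k \<in> mcball a (\<epsilon> / 3)"
        using K(2) by blast
      note za = z[OF a(2)]
      have "d (z a) (y k) \<le> d (z a) a + d a (y k)"
        using za a(2) by (intro triangle) auto
      also have "\<dots> < \<epsilon>"
        using za a(2) \<open>\<epsilon> > 0\<close> by (simp add: commute)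
      finally have "y k \<in> mball (z a) \<epsilon>"
        using za a(2) by simp
      then show ?thesis
        using a by blast
    qed
    moreover have "finite ?K" "?K \<subseteq> range y"
      using K(1) z by auto
    ultimately show "\<exists>K. finite K \<and> K \<subseteq> range y \<and> range y \<subseteq> (\<Union>x\<in>K. mball x \<epsilon>)"
      by (intro exI[of _ ?K]) blast
  qed
  then obtain r :: "nat \<Rightarrow> nat" where r: "strict_mono r" "MCauchy (y \<circ> r)"
    unfolding mtotally_bounded_sequentially by blast
  then obtain l where l: "limitin mtopology (y \<circ> r) l sequentially"
    using \<open>mcomplete\<close> unfolding mcomplete_def by blast
  have "l \<in> C n" for n
  proof (rule limitin_closedin[OF l C(1)])
    have "(y \<circ> r) k \<in> C n" if "k \<ge> n" for k
    proof -
      have "C (r k) \<subseteq> C n"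
        using seq_suble[OF r(1), of k] that by (intro decseqD[OF C(2)]) simp
      then show ?thesis
        using y[of "r k"] by auto
    qed
    then show "\<forall>\<^sub>F k in sequentially. (y \<circ> r) k \<in> C n"
      unfolding eventually_sequentially by blast
  qed simp
  with r(1) l show ?thesis
    by blast
qed

text \<open>Both parts extract a limit: from a sequence inside the intersection, or from points of
  \<open>C n \<inter> A\<close> if none of these sets were empty. The first gives compact values,
  the second upper semicontinuity, since a closed set missing the intersection already misses one
  \<open>C n\<close>.\<close>

lemma closed_decseq_Inter:
  assumes "mcomplete" and C: "\<And>n. closedin mtopology (C n)" "decseq C"
    and small: "\<forall>\<epsilon>>0. \<exists>n K. finite K \<and> C n \<subseteq> (\<Union>a\<in>K. mcball a \<epsilon>)"
  shows compactin_closed_decseq_Inter: "compactin mtopology (\<Inter>n. C n)"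
    and closed_decseq_disjoint: "\<And>A. closedin mtopology A \<Longrightarrow> (\<Inter>n. C n) \<inter> A = {} \<Longrightarrow> \<exists>n. C n \<inter> A = {}"
proof -
  show "compactin mtopology (\<Inter>n. C n)"
    unfolding compactin_sequentially
  proof (intro conjI allI impI)
    show "(\<Inter>n. C n) \<subseteq> M"
      using closedin_subset[OF C(1)[of 0]] by auto
    fix \<sigma> :: "nat \<Rightarrow> 'a"
    assume "range \<sigma> \<subseteq> (\<Inter>n. C n)"
    then have "\<sigma> n \<in> C n" for n
      by blast
    from closed_decseq_convergent_subsequence[OF assms, of \<sigma>, OF this]
    show "\<exists>l r. l \<in> (\<Inter>n. C n) \<and> strict_mono r \<and> limitin mtopology (\<sigma> \<circ> r) l sequentially"
      by blast
  qed
  fix A assume A: "closedin mtopology A" "(\<Inter>n. C n) \<inter> A = {}"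
  show "\<exists>n. C n \<inter> A = {}"
  proof (rule ccontr)
    assume "\<nexists>n. C n \<inter> A = {}"
    then have "\<forall>n. \<exists>y. y \<in> C n \<and> y \<in> A"
      by blast
    then obtain y where y: "\<And>n. y n \<in> C n" "\<And>n. y n \<in> A"
      by metis
    obtain l r where lr: "strict_mono r" "limitin mtopology (y \<circ> r) l sequentially" "\<And>n. l \<in> C n"
      using closed_decseq_convergent_subsequence[OF assms, of y, OF y(1)] by blast
    have "l \<in> A"
      by (rule limitin_closedin[OF lr(2) A(1)]) (auto simp: y(2))
    with lr(3) A(2) show False
      by blast
  qed
qed

end

section \<open>Compact-valued u.s.c. selections of l.s.c. mappings\<close>

text \<open>
  Every \<open>x\<close> picks out the finitely branching subtree of the nodes \<open>s\<close> with
  \<open>x \<in> F s\<close>. The sets \<open>K n x\<close>, unions of the closures of the finitely many nodes at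
  level \<open>n\<close>, decrease to the compact value at \<open>x\<close>.
\<close>

theorem usc_compact_selection:
  fixes Y :: "'b topology" and \<Phi> :: "'a \<Rightarrow> 'b set"
  assumes \<tau>: "Card_order \<tau>" "infinite (Field \<tau>)" and X: "normal_space X" "tau_paracompact \<tau> X"
    and Y: "completely_metrizable_space Y" "weight Y \<le>o \<tau>"
    and \<Phi>: "\<Phi> \<in> topspace X \<rightarrow> nonempty_closed_sets Y" "lsc X Y \<Phi>"
  obtains \<psi> where "\<psi> \<in> topspace X \<rightarrow> nonempty_compact_sets Y" "usc X Y \<psi>" "svm_le X \<psi> \<Phi>"
proof -
  obtain M d where "Metric_space M d" and complete: "Metric_space.mcomplete M d"
      and Y_eq: "Y = Metric_space.mtopology M d"
    using Y(1) unfolding completely_metrizable_space_def by blast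
  interpret Metric_space M d by fact
  obtain \<B> where \<B>: "topology_base Y \<B>" "|\<B>| \<le>o \<tau>"
    using Y(2) unfolding weight_ordLeq_iff by blast
  define small where "small n B \<longleftrightarrow> B \<in> \<B> \<and> (\<exists>a\<in>M. B \<subseteq> mball a (inverse (Suc n)))" for n B
  \<comment> \<open>Each new entry cuts \<open>U s\<close> down by a basic set whose radius shrinks
    with the level. A list with an inadmissible entry gets the empty set, which makes
    \<open>U\<close> total on lists.\<close>
  define U where "U = rec_list M (\<lambda>B s A. if small (length s) B then A \<inter> B else {})"
  have U_Nil: "U [] = M"
    and U_Cons: "U (B # s) = (if small (length s) B then U s \<inter> B else {})" for B s
    unfolding U_def by simp_all
  have U_open: "openin Y (U s)" for s
    using \<B>(1) by (induction s) (auto simp: U_Nil U_Cons Y_eq small_def topology_base_def)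
  have U_ball: "\<exists>a. U s \<subseteq> mball a (inverse (Suc n))" if "length s = Suc n" for s n
  proof -
    obtain B t where "s = B # t" "length t = n"
      using \<open>length s = Suc n\<close> by (auto simp: length_Suc_conv)
    then show ?thesis
      by (auto simp: U_Cons small_def)
  qed
  define W where "W s = {x \<in> topspace X. \<Phi> x \<inter> U s \<noteq> {}}" for s
  have \<Phi>_ne: "\<Phi> x \<noteq> {}" "closedin Y (\<Phi> x)" if "x \<in> topspace X" for x
    using \<Phi>(1) that unfolding nonempty_closed_sets_def by auto
  have W_open: "openin X (W s)" for s
    using \<Phi>(2) U_open unfolding lsc_def W_def by blast
  have W_Nil: "topspace X \<subseteq> W []"
  proof
    fix x assume x: "x \<in> topspace X"
    then have "\<Phi> x \<inter> M = \<Phi> x"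
      using closedin_subset[OF \<Phi>_ne(2)] Y_eq by auto
    then show "x \<in> W []"
      using x \<Phi>_ne(1) by (simp add: W_def U_Nil)
  qed
  have W_split: "W s \<subseteq> (\<Union>B\<in>\<B>. W (B # s))" for s
  proof
    fix x assume "x \<in> W s"
    then obtain y where y: "x \<in> topspace X" "y \<in> \<Phi> x" "y \<in> U s"
      unfolding W_def by blast
    have "y \<in> M"
      using y(3) openin_subset[OF U_open] Y_eq by auto
    then have "openin Y (mball y (inverse (Suc (length s))))" "y \<in> mball y (inverse (Suc (length s)))"
      unfolding Y_eq by simp_all
    then obtain B where B: "B \<in> \<B>" "y \<in> B" "B \<subseteq> mball y (inverse (Suc (length s)))"
      using \<B>(1) unfolding topology_base_def by meson
    then have "small (length s) B"
      using \<open>y \<in> M\<close> unfolding small_def by blast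
    then show "x \<in> (\<Union>B\<in>\<B>. W (B # s))"
      using y B(1,2) by (auto simp: W_def U_Cons)
  qed
  obtain F where F: "\<And>s. closedin X (F s)" "\<And>s. F s \<subseteq> W s" "F [] = topspace X"
    "\<And>s. F s = (\<Union>i. F (i # s))"
    "\<And>n. locally_finite_family X (\<lambda>s. if length s = n then F s else {})"
    by (rule tau_paracompact_closed_sieve[OF \<tau> X \<B>(2) W_open W_Nil W_split]) (rule that)
  define L where "L n x = {s. length s = n \<and> x \<in> F s}" for n x
  have L_fin: "finite (L n x)" if "x \<in> topspace X" for n x
  proof -
    have "{s. x \<in> (if length s = n then F s else {})} = L n x"
      unfolding L_def by auto
    then show ?thesis
      using locally_finite_family_finite[OF F(5)[of n] that] by simp
  qed
  have L_ne: "L n x \<noteq> {}" if x: "x \<in> topspace X" for n x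
  proof (induction n)
    case 0
    then show ?case
      using x F(3) unfolding L_def by auto
  next
    case (Suc n)
    then obtain s where s: "length s = n" "x \<in> F s"
      unfolding L_def by blast
    then obtain i where "x \<in> F (i # s)"
      using F(4)[of s] by blast
    then have "i # s \<in> L (Suc n) x"
      using s unfolding L_def by simp
    then show ?case by blast
  qed
  define K where "K n x = (\<Union>s\<in>L n x. Y closure_of U s)" for n x
  have K_closed: "closedin Y (K n x)" if "x \<in> topspace X" for n x
    using L_fin[OF that] unfolding K_def by (intro closedin_Union) auto
  have K_ne: "K n x \<noteq> {}" if x: "x \<in> topspace X" for n x
  proof -
    obtain s where s: "s \<in> L n x"
      using L_ne[OF x] by blast
    then have "U s \<noteq> {}"
      using F(2)[of s] unfolding L_def W_def by blast
    moreover have "U s \<subseteq> Y closure_of U s"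
      using U_open closure_of_subset openin_subset by metis
    ultimately show ?thesis
      using s unfolding K_def by blast
  qed
  have K_dec: "decseq (\<lambda>n. K n x)" for x
  proof (rule decseq_SucI, unfold K_def, rule UN_least)
    fix n s assume s: "s \<in> L (Suc n) x"
    then obtain B t where t: "s = B # t" "length t = n"
      unfolding L_def by (auto simp: length_Suc_conv)
    then have "t \<in> L n x"
      using s F(4)[of t] unfolding L_def by blast
    moreover have "Y closure_of U s \<subseteq> Y closure_of U t"
      unfolding t by (intro closure_of_mono) (simp add: U_Cons)
    ultimately show "Y closure_of U s \<subseteq> (\<Union>s\<in>L n x. Y closure_of U s)"
      by blast
  qed
  \<comment> \<open>The level is \<open>Suc n\<close> because the root \<open>U []\<close> is all of
    \<open>M\<close> and need not lie in a ball.\<close>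
  have cl_ball: "\<exists>a. Y closure_of U s \<subseteq> mcball a (inverse (Suc n))" if s: "s \<in> L (Suc n) x" for s n x
  proof -
    obtain a where "U s \<subseteq> mball a (inverse (Suc n))"
      using U_ball[of s n] s unfolding L_def by blast
    then have "U s \<subseteq> mcball a (inverse (Suc n))"
      using mball_subset_mcball by blast
    then show ?thesis
      unfolding Y_eq by (intro exI[of _ a] closure_of_minimal) auto
  qed
  have K_small: "\<forall>\<epsilon>>0. \<exists>n T. finite T \<and> K n x \<subseteq> (\<Union>a\<in>T. mcball a \<epsilon>)" if x: "x \<in> topspace X" for x
  proof (intro allI impI)
    fix \<epsilon> :: real assume "\<epsilon> > 0"
    obtain n where n: "inverse (Suc n) < \<epsilon>"
      using \<open>\<epsilon> > 0\<close> reals_Archimedean by blast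
    have "\<forall>s\<in>L (Suc n) x. \<exists>a. Y closure_of U s \<subseteq> mcball a (inverse (Suc n))"
      using cl_ball by blast
    then obtain a where a: "\<And>s. s \<in> L (Suc n) x \<Longrightarrow> Y closure_of U s \<subseteq> mcball (a s) (inverse (Suc n))"
      by metis
    have "mcball (a s) (inverse (Suc n)) \<subseteq> mcball (a s) \<epsilon>" for s
      using n by (intro mcball_subset_concentric) simp
    then have "K (Suc n) x \<subseteq> (\<Union>a\<in>a ` L (Suc n) x. mcball a \<epsilon>)"
      using a unfolding K_def by blast
    then show "\<exists>n T. finite T \<and> K n x \<subseteq> (\<Union>a\<in>T. mcball a \<epsilon>)"
      using L_fin[OF x] finite_imageI by meson
  qed
  define \<psi> where "\<psi> x = (\<Inter>n. K n x)" for x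
  have \<psi>: "compactin Y (\<psi> x)"
      and \<psi>_disjoint: "\<And>A. closedin Y A \<Longrightarrow> \<psi> x \<inter> A = {} \<Longrightarrow> \<exists>n. K n x \<inter> A = {}"
    if x: "x \<in> topspace X" for x
    using closed_decseq_Inter[of "\<lambda>n. K n x", OF complete _ K_dec K_small[OF x]] K_closed[OF x]
    unfolding \<psi>_def Y_eq by blast+
  \<comment> \<open>An empty intersection would miss the closed set \<open>topspace Y\<close>, and
    then some \<open>K n x\<close> would be empty.\<close>
  have \<psi>_ne: "\<psi> x \<noteq> {}" if x: "x \<in> topspace X" for x
  proof
    assume "\<psi> x = {}"
    then obtain n where "K n x \<inter> topspace Y = {}"
      using \<psi>_disjoint[OF x closedin_topspace] by blast
    then show False
      using K_ne[OF x, of n] closedin_subset[OF K_closed[OF x, of n]] by blast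
  qed
  show ?thesis
  proof
    show "\<psi> \<in> topspace X \<rightarrow> nonempty_compact_sets Y"
      using \<psi> \<psi>_ne unfolding nonempty_compact_sets_def by blast
    show "usc X Y \<psi>"
      unfolding usc_def
    proof (intro allI impI)
      fix A assume A: "closedin Y A"
      let ?S = "{x \<in> topspace X. \<psi> x \<inter> A \<noteq> {}}"
      have "\<exists>T. openin X T \<and> x \<in> T \<and> T \<subseteq> topspace X - ?S" if x: "x \<in> topspace X - ?S" for x
      proof -
        obtain n where n: "K n x \<inter> A = {}"
          using \<psi>_disjoint[OF _ A] x by blast
        \<comment> \<open>Removing the level-\<open>n\<close> sets \<open>F s\<close> that miss
          \<open>x\<close> leaves a neighbourhood of \<open>x\<close>, by local finiteness. Its
          points have no level-\<open>n\<close> nodes beyond those of \<open>x\<close>, so their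
          values stay in \<open>K n x\<close>.\<close>
        let ?F = "\<lambda>s. if length s = n then F s else {}"
        have "closedin X (\<Union>s\<in>{s. x \<notin> F s}. ?F s)"
          by (rule closedin_UN_locally_finite_family[OF F(5)]) (simp add: F(1))
        then have "openin X (topspace X - (\<Union>s\<in>{s. x \<notin> F s}. ?F s))" (is "openin X ?T")
          by blast
        moreover have "x \<in> ?T"
          using x by auto
        moreover have "?T \<subseteq> topspace X - ?S"
        proof
          fix x' assume x': "x' \<in> ?T"
          then have "L n x' \<subseteq> L n x"
            unfolding L_def by (auto split: if_splits)
          then have "\<psi> x' \<subseteq> K n x"
            unfolding \<psi>_def K_def by blast
          then show "x' \<in> topspace X - ?S"
            using n x' by blast
        qed
        ultimately show ?thesis by blast
      qed
      then have "openin X (topspace X - ?S)"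
        by (subst openin_subopen) blast
      then show "closedin X ?S"
        unfolding closedin_def by blast
    qed
    show "svm_le X \<psi> \<Phi>"
      unfolding svm_le_def
    proof (intro ballI subsetI)
      fix x y assume x: "x \<in> topspace X" and y: "y \<in> \<psi> x"
      show "y \<in> \<Phi> x"
      proof (rule ccontr)
        assume "y \<notin> \<Phi> x"
        moreover have "y \<in> M"
          using y compactin_subset_topspace[OF \<psi>[OF x]] Y_eq by auto
        moreover have "closedin mtopology (\<Phi> x)"
          using \<Phi>_ne(2)[OF x] Y_eq by simp
        ultimately obtain \<epsilon> where \<epsilon>: "\<epsilon> > 0" "disjnt (\<Phi> x) (mball y \<epsilon>)"
          unfolding closedin_metric by blast
        obtain n where n: "inverse (Suc n) < \<epsilon> / 2"
          using \<epsilon>(1) reals_Archimedean[of "\<epsilon> / 2"] by auto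
        have "y \<in> K (Suc n) x"
          using y unfolding \<psi>_def by blast
        then obtain s where s: "s \<in> L (Suc n) x" "y \<in> Y closure_of U s"
          unfolding K_def by blast
        then obtain a where a: "Y closure_of U s \<subseteq> mcball a (inverse (Suc n))"
          using cl_ball by blast
        \<comment> \<open>Since \<open>F s\<close> lies in \<open>W s\<close>, the node
          \<open>s\<close> also contains a point of \<open>\<Phi> x\<close>, and one ball of radius
          below \<open>\<epsilon> / 2\<close> holds both it and \<open>y\<close>.\<close>
        obtain z where z: "z \<in> \<Phi> x" "z \<in> U s"
          using s(1) F(2)[of s] unfolding L_def W_def by blast
        then have "z \<in> Y closure_of U s"
          using closure_of_subset[OF openin_subset[OF U_open[of s]]] by blast
        then have az: "z \<in> mcball a (inverse (Suc n))" and ay: "y \<in> mcball a (inverse (Suc n))"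
          using a s(2) by blast+
        then have "d y z \<le> d y a + d a z"
          by (intro triangle) auto
        also have "\<dots> < \<epsilon>"
          using az ay n by (simp add: commute)
        finally have "z \<in> mball y \<epsilon>"
          using az ay by simp
        then show False
          using \<epsilon>(2) z(1) unfolding disjnt_def by blast
      qed
    qed
  qed
qed

section \<open>From normality and paracompactness to the extension property\<close>

lemma usc_openin:
  assumes "usc X Y \<theta>" and "openin Y V" and "\<theta> \<in> topspace X \<rightarrow> Pow (topspace Y)"
  shows "openin X {x \<in> topspace X. \<theta> x \<subseteq> V}"
proof -
  have "closedin X {x \<in> topspace X. \<theta> x \<inter> (topspace Y - V) \<noteq> {}}"
    using assms(1,2) unfolding usc_def by blast
  then have "openin X (topspace X - {x \<in> topspace X. \<theta> x \<inter> (topspace Y - V) \<noteq> {}})"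
    by (rule openin_diff[OF openin_topspace])
  moreover have "{x \<in> topspace X. \<theta> x \<subseteq> V} =
      topspace X - {x \<in> topspace X. \<theta> x \<inter> (topspace Y - V) \<noteq> {}}"
    using assms(3) by (auto simp: Pi_iff)
  ultimately show ?thesis
    by simp
qed

text \<open>An open set meets a closure iff it meets the set itself, and meeting
  \<open>\<Phi> x \<inter> B\<close> is the stronger demand. So the stronger condition may be
  allowed everywhere and the weaker one only off \<open>E\<close>, which gives a union of two open
  sets.\<close>

lemma lsc_closure_of_Int:
  assumes "lsc X Y \<Phi>" and "openin Y B" and "closedin X E"
  shows "lsc X Y (\<lambda>x. if x \<in> E then Y closure_of (\<Phi> x \<inter> B) else \<Phi> x)" (is "lsc X Y ?\<Psi>")
  unfolding lsc_def
proof (intro allI impI)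
  fix U assume U: "openin Y U"
  have "?\<Psi> x \<inter> U \<noteq> {} \<longleftrightarrow> \<Phi> x \<inter> (U \<inter> B) \<noteq> {} \<or> (x \<notin> E \<and> \<Phi> x \<inter> U \<noteq> {})" for x
    using openin_Int_closure_of_eq_empty[OF U, of "\<Phi> x \<inter> B"] by auto
  then have "{x \<in> topspace X. ?\<Psi> x \<inter> U \<noteq> {}} =
      {x \<in> topspace X. \<Phi> x \<inter> (U \<inter> B) \<noteq> {}} \<union> ({x \<in> topspace X. \<Phi> x \<inter> U \<noteq> {}} - E)"
    by blast
  moreover have "openin X {x \<in> topspace X. \<Phi> x \<inter> (U \<inter> B) \<noteq> {}}"
      "openin X {x \<in> topspace X. \<Phi> x \<inter> U \<noteq> {}}"
    using assms(1,2) U unfolding lsc_def by (simp_all add: openin_Int)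
  ultimately show "openin X {x \<in> topspace X. ?\<Psi> x \<inter> U \<noteq> {}}"
    using assms(3) by (simp add: openin_Un openin_diff)
qed

text \<open>Separate \<open>C\<close> and \<open>y\<close> by disjoint open sets, take
  \<open>B\<close> on the side of \<open>y\<close>, and cover \<open>C\<close> by finitely many
  basic sets on the other side. An open set disjoint from \<open>B\<close> also misses its closure.
  Finiteness of \<open>\<F>\<close> bounds the number of possible pairs.\<close>

lemma separate_compact_point:
  assumes Y: "metrizable_space Y" and \<B>: "topology_base Y \<B>"
    and C: "compactin Y C" and y: "y \<in> topspace Y - C"
  obtains \<F> B where "\<F> \<in> Fpow \<B>" "B \<in> \<B>" "C \<subseteq> \<Union>\<F>" "y \<in> B" "\<Union>\<F> \<inter> Y closure_of B = {}"
proof -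
  have "compactin Y {y}" "disjnt C {y}"
    using y by (auto simp: disjnt_def)
  then obtain U V where UV: "openin Y U" "openin Y V" "C \<subseteq> U" "{y} \<subseteq> V" "disjnt U V"
    using C Hausdorff_space_compact_separation[OF metrizable_imp_Hausdorff_space[OF Y], of C "{y}"] by blast
  obtain B where B: "B \<in> \<B>" "y \<in> B" "B \<subseteq> V"
    using UV(2,4) \<B> unfolding topology_base_def by (metis insert_subset)
  have "\<forall>z\<in>C. \<exists>A\<in>\<B>. z \<in> A \<and> A \<subseteq> U"
    using UV(1,3) \<B> unfolding topology_base_def by blast
  then have "C \<subseteq> \<Union>{A \<in> \<B>. A \<subseteq> U}"
    by blast
  moreover have "\<forall>A \<in> {A \<in> \<B>. A \<subseteq> U}. openin Y A"
    using \<B> unfolding topology_base_def by blast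
  ultimately obtain \<F> where \<F>: "finite \<F>" "\<F> \<subseteq> {A \<in> \<B>. A \<subseteq> U}" "C \<subseteq> \<Union>\<F>"
    using C unfolding compactin_def by meson
  have "U \<inter> B = {}"
    using B(3) UV(5) unfolding disjnt_def by blast
  then have "U \<inter> Y closure_of B = {}"
    using openin_Int_closure_of_eq_empty[OF UV(1)] by blast
  then have "\<Union>\<F> \<inter> Y closure_of B = {}"
    using \<F>(2) by blast
  moreover have "\<F> \<in> Fpow \<B>"
    using \<F> unfolding Fpow_def by blast
  ultimately show ?thesis
    using that \<F>(3) B(1,2) by blast
qed

theorem strict_usc_extension_if_tau_paracompact:
  fixes X :: "'a topology"
  assumes \<tau>: "Card_order \<tau>" "infinite (Field \<tau>)" and X: "normal_space X" "tau_paracompact \<tau> X"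
  shows "strict_usc_extension \<tau> X TYPE('b)"
  unfolding strict_usc_extension_def
proof (intro allI impI, elim conjE)
  fix Y :: "'b topology" and \<Phi> \<theta> :: "'a \<Rightarrow> 'b set"
  assume Y: "completely_metrizable_space Y" "weight Y \<le>o \<tau>"
    and \<Phi>: "\<Phi> \<in> topspace X \<rightarrow> nonempty_closed_sets Y" "lsc X Y \<Phi>"
    and \<theta>: "\<theta> \<in> topspace X \<rightarrow> nonempty_compact_sets Y" "usc X Y \<theta>"
    and less: "svm_less X \<theta> \<Phi>"
  have Y_met: "metrizable_space Y"
    using Y(1) by (rule completely_metrizable_imp_metrizable_space)
  have \<Phi>_ne: "\<Phi> x \<noteq> {}" "closedin Y (\<Phi> x)" if "x \<in> topspace X" for x
    using \<Phi>(1) that unfolding nonempty_closed_sets_def by auto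
  have \<theta>_ne: "\<theta> x \<noteq> {}" "compactin Y (\<theta> x)" if "x \<in> topspace X" for x
    using \<theta>(1) that unfolding nonempty_compact_sets_def by auto
  have \<theta>_le: "\<theta> x \<subseteq> \<Phi> x" "\<Phi> x - \<theta> x \<noteq> {}" if "x \<in> topspace X" for x
    using less that unfolding svm_less_def svm_le_def by auto
  have \<theta>_Pow: "\<theta> \<in> topspace X \<rightarrow> Pow (topspace Y)"
    using \<theta>_ne(2) compactin_subset_topspace by blast
  obtain \<B> where \<B>: "topology_base Y \<B>" "|\<B>| \<le>o \<tau>"
    using Y(2) unfolding weight_ordLeq_iff by blast
  have \<B>_open: "openin Y B" if "B \<in> \<B>" for B
    using \<B>(1) that unfolding topology_base_def by blast
  define I where "I = {(\<F>, B) \<in> Fpow \<B> \<times> \<B>. \<Union>\<F> \<inter> Y closure_of B = {}}"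
  have "|Fpow \<B> \<times> \<B>| \<le>o \<tau>"
    using \<tau> Fpow_ordLeq_infinite_Card_order[OF \<B>(2) \<tau>] \<B>(2)
    by (intro card_of_Times_ordLeq_infinite_Field) auto
  moreover have "I \<subseteq> Fpow \<B> \<times> \<B>"
    unfolding I_def by blast
  ultimately have I: "|I| \<le>o \<tau>"
    using card_of_mono1 ordLeq_transitive by blast
  define W where "W i = {x \<in> topspace X. \<theta> x \<subseteq> \<Union>(fst i)} \<inter> {x \<in> topspace X. \<Phi> x \<inter> snd i \<noteq> {}}" for i
  have W_open: "openin X (W i)" if "i \<in> I" for i
  proof -
    have "\<forall>A\<in>fst i. openin Y A" "openin Y (snd i)"
      using that \<B>_open unfolding I_def Fpow_def by auto
    then have "openin Y (\<Union>(fst i))" "openin Y (snd i)"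
      by blast+
    then show ?thesis
      using usc_openin[OF \<theta>(2) _ \<theta>_Pow] \<Phi>(2) unfolding W_def lsc_def by (intro openin_Int) blast+
  qed
  have W_cover: "topspace X \<subseteq> (\<Union>i\<in>I. W i)"
  proof
    fix x assume x: "x \<in> topspace X"
    obtain y where y: "y \<in> \<Phi> x" "y \<notin> \<theta> x"
      using \<theta>_le(2)[OF x] by blast
    then have "y \<in> topspace Y - \<theta> x"
      using closedin_subset[OF \<Phi>_ne(2)[OF x]] by blast
    then obtain \<F> B where FB: "\<F> \<in> Fpow \<B>" "B \<in> \<B>" "\<theta> x \<subseteq> \<Union>\<F>" "y \<in> B" "\<Union>\<F> \<inter> Y closure_of B = {}"
      by (rule separate_compact_point[OF Y_met \<B>(1) \<theta>_ne(2)[OF x]])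
    then have "(\<F>, B) \<in> I" "x \<in> W (\<F>, B)"
      using x y(1) unfolding I_def W_def by auto
    then show "x \<in> (\<Union>i\<in>I. W i)"
      by blast
  qed
  obtain E where E: "\<And>i. closedin X (E i)" "\<And>i. E i \<subseteq> W i" "topspace X = (\<Union>i. E i)"
      "\<And>i. i \<notin> I \<Longrightarrow> E i = {}" "locally_finite_family X E"
    by (rule tau_paracompact_closed_refinement[OF \<tau> X I W_open closedin_topspace W_cover]) (assumption, rule that)
  have "\<exists>\<sigma>. \<sigma> \<in> topspace X \<rightarrow> nonempty_compact_sets Y \<and> usc X Y \<sigma> \<and>
      (\<forall>x\<in>E i. \<sigma> x \<subseteq> \<Phi> x \<inter> Y closure_of snd i)" for i
  proof (cases "i \<in> I")
    case True
    \<comment> \<open>Off \<open>E i\<close>, where \<open>\<Phi> x \<inter> snd i\<close> may be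
      empty, \<open>\<Psi>\<close> falls back to \<open>\<Phi>\<close>, so that the selection
      theorem applies on all of \<open>X\<close>.\<close>
    define \<Psi> where "\<Psi> x = (if x \<in> E i then Y closure_of (\<Phi> x \<inter> snd i) else \<Phi> x)" for x
    have B: "openin Y (snd i)"
      using True \<B>_open unfolding I_def by auto
    have "lsc X Y \<Psi>"
      unfolding \<Psi>_def by (rule lsc_closure_of_Int[OF \<Phi>(2) B E(1)])
    moreover have "\<Psi> \<in> topspace X \<rightarrow> nonempty_closed_sets Y"
    proof
      fix x assume x: "x \<in> topspace X"
      have "Y closure_of (\<Phi> x \<inter> snd i) \<noteq> {}" if "x \<in> E i"
        using E(2)[of i] that openin_subset[OF B] closure_of_subset[of "\<Phi> x \<inter> snd i" Y] unfolding W_def by blast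
      then show "\<Psi> x \<in> nonempty_closed_sets Y"
        using \<Phi>_ne[OF x] unfolding \<Psi>_def nonempty_closed_sets_def by simp
    qed
    ultimately obtain \<sigma> where \<sigma>: "\<sigma> \<in> topspace X \<rightarrow> nonempty_compact_sets Y" "usc X Y \<sigma>" "svm_le X \<sigma> \<Psi>"
      using usc_compact_selection[OF \<tau> X Y, of \<Psi>] by blast
    have "\<sigma> x \<subseteq> \<Phi> x \<inter> Y closure_of snd i" if x: "x \<in> E i" for x
    proof -
      have X: "x \<in> topspace X"
        using x E(1) closedin_subset by blast
      then have "\<sigma> x \<subseteq> \<Psi> x"
        using \<sigma>(3) unfolding svm_le_def by blast
      then have "\<sigma> x \<subseteq> Y closure_of (\<Phi> x \<inter> snd i)"
        using x by (simp add: \<Psi>_def)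
      moreover have "Y closure_of (\<Phi> x \<inter> snd i) \<subseteq> \<Phi> x"
        using \<Phi>_ne(2)[OF X] by (intro closure_of_minimal) auto
      moreover have "Y closure_of (\<Phi> x \<inter> snd i) \<subseteq> Y closure_of snd i"
        by (intro closure_of_mono) auto
      ultimately show ?thesis by blast
    qed
    with \<sigma>(1,2) show ?thesis by blast
  next
    \<comment> \<open>Here \<open>E i\<close> is empty and the containment is vacuous;
      \<open>\<theta>\<close> serves as a default compact-valued u.s.c. mapping.\<close>
    case False
    then show ?thesis
      using \<theta> E(4)[OF False] by (intro exI[of _ \<theta>]) simp
  qed
  then obtain \<sigma> where \<sigma>: "\<And>i. \<sigma> i \<in> topspace X \<rightarrow> nonempty_compact_sets Y" "\<And>i. usc X Y (\<sigma> i)"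
      "\<And>i x. x \<in> E i \<Longrightarrow> \<sigma> i x \<subseteq> \<Phi> x \<inter> Y closure_of snd i"
    by metis
  define \<psi> where "\<psi> x = \<theta> x \<union> (\<Union>i\<in>{i. x \<in> E i}. \<sigma> i x)" for x
  show "\<exists>\<psi>. \<psi> \<in> topspace X \<rightarrow> nonempty_compact_sets Y \<and> usc X Y \<psi> \<and> svm_less X \<theta> \<psi> \<and> svm_le X \<psi> \<Phi>"
  proof (intro exI conjI)
    show "\<psi> \<in> topspace X \<rightarrow> nonempty_compact_sets Y"
    proof
      fix x assume x: "x \<in> topspace X"
      have "compactin Y (\<Union>i\<in>{i. x \<in> E i}. \<sigma> i x)"
        using locally_finite_family_finite[OF E(5) x] \<sigma>(1) x
        by (intro compactin_Union) (auto simp: nonempty_compact_sets_def)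
      then show "\<psi> x \<in> nonempty_compact_sets Y"
        using \<theta>_ne[OF x] unfolding \<psi>_def nonempty_compact_sets_def by (simp add: compactin_Un)
    qed
    show "usc X Y \<psi>"
      unfolding usc_def
    proof (intro allI impI)
      fix A assume A: "closedin Y A"
      \<comment> \<open>The part of \<open>\<psi>\<close> beyond \<open>\<theta>\<close> meets
        \<open>A\<close> on the union of these closed sets, which is closed because they inherit
        local finiteness from \<open>E\<close>.\<close>
      let ?G = "\<lambda>i. E i \<inter> {x \<in> topspace X. \<sigma> i x \<inter> A \<noteq> {}}"
      have "closedin X (\<Union>i. ?G i)"
      proof (rule closedin_UN_locally_finite_family)
        show "locally_finite_family X ?G"
          using E(5) by (rule locally_finite_family_mono) blast
        show "closedin X (?G i)" for i
          using E(1) \<sigma>(2) A unfolding usc_def by (intro closedin_Int) blast+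
      qed
      moreover have "closedin X {x \<in> topspace X. \<theta> x \<inter> A \<noteq> {}}"
        using \<theta>(2) A unfolding usc_def by blast
      moreover have "{x \<in> topspace X. \<psi> x \<inter> A \<noteq> {}} = {x \<in> topspace X. \<theta> x \<inter> A \<noteq> {}} \<union> (\<Union>i. ?G i)"
        unfolding \<psi>_def by blast
      ultimately show "closedin X {x \<in> topspace X. \<psi> x \<inter> A \<noteq> {}}"
        by (simp add: closedin_Un)
    qed
    show "svm_less X \<theta> \<psi>"
      unfolding svm_less_def svm_le_def
    proof (intro conjI ballI)
      fix x assume x: "x \<in> topspace X"
      show "\<theta> x \<subseteq> \<psi> x"
        unfolding \<psi>_def by blast
      \<comment> \<open>The nonempty value \<open>\<sigma> i x\<close> lies in the closure of
        \<open>snd i\<close>, hence outside \<open>\<Union>(fst i)\<close>, which contains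
        \<open>\<theta> x\<close>; it provides the new point.\<close>
      obtain i where i: "x \<in> E i"
        using x unfolding E(3) by blast
      have "\<sigma> i x \<noteq> {}"
        using \<sigma>(1) x unfolding nonempty_compact_sets_def by blast
      moreover have "\<sigma> i x \<subseteq> Y closure_of snd i"
        using \<sigma>(3)[OF i] by blast
      moreover have "\<theta> x \<subseteq> \<Union>(fst i)"
        using E(2)[of i] i unfolding W_def by blast
      moreover have "\<Union>(fst i) \<inter> Y closure_of snd i = {}"
        using E(4)[of i] i unfolding I_def by force
      ultimately show "\<psi> x - \<theta> x \<noteq> {}"
        using i unfolding \<psi>_def by blast
    qed
    show "svm_le X \<psi> \<Phi>"
      unfolding svm_le_def \<psi>_def using \<theta>_le(1) \<sigma>(3) by blast
  qed
qed

section \<open>From the extension property back to normality and paracompactness\<close>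

lemma weight_discrete_topology_ordLeq:
  assumes "|D| \<le>o \<tau>"
  shows "weight (discrete_topology D) \<le>o \<tau>"
  unfolding weight_ordLeq_iff
proof (intro exI conjI)
  show "topology_base (discrete_topology D) ((\<lambda>y. {y}) ` D)"
    unfolding topology_base_def by auto
  show "|(\<lambda>y. {y}) ` D| \<le>o \<tau>"
    using assms card_of_image ordLeq_transitive by blast
qed

text \<open>
  The extension property is applied to the discrete space on \<open>I\<close> with one point added: that
  point is the only value of \<open>\<theta>\<close>, so strictness forces the extension to meet \<open>I\<close>.
\<close>

lemma strict_usc_extension_finite_selection:
  fixes \<tau> :: "'k rel" and U :: "'i \<Rightarrow> 'a set"
  assumes \<tau>: "Card_order \<tau>" "infinite (Field \<tau>)"
    and ext: "strict_usc_extension \<tau> X TYPE(nat \<Rightarrow> 'k)"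
    and I: "|I| \<le>o \<tau>" and U: "\<And>i. i \<in> I \<Longrightarrow> openin X (U i)" "topspace X \<subseteq> (\<Union>i\<in>I. U i)"
  obtains \<phi> where "\<And>x. x \<in> topspace X \<Longrightarrow> finite (\<phi> x)" "\<And>x. x \<in> topspace X \<Longrightarrow> \<phi> x \<noteq> {}"
    "\<And>x. x \<in> topspace X \<Longrightarrow> \<phi> x \<subseteq> {i \<in> I. x \<in> U i}"
    "\<And>J. closedin X {x \<in> topspace X. \<phi> x \<inter> J \<noteq> {}}"
proof -
  have \<tau>_Field: "\<tau> =o |Field \<tau>|"
    using \<tau>(1) card_of_Field_ordIso ordIso_symmetric by blast
  then have "|I| \<le>o |Field \<tau>|"
    using I ordLeq_ordIso_trans by blast
  then obtain f where f: "inj_on f I" "f ` I \<subseteq> Field \<tau>"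
    using card_of_ordLeq by metis
  obtain a b where ab: "a \<in> Field \<tau>" "b \<in> Field \<tau>" "a \<noteq> b"
    using \<tau>(2) by (metis finite.simps insertI1 finite_subset singletonI subsetI)
  \<comment> \<open>Position \<open>0\<close> of \<open>e k\<close> stores \<open>k\<close> and all
    others hold \<open>a\<close>, so the sequence with constant value \<open>b\<close> is a point
    outside the range of \<open>e\<close>.\<close>
  define e :: "'k \<Rightarrow> nat \<Rightarrow> 'k" where "e k = (\<lambda>n. if n = 0 then k else a)" for k
  define p :: "nat \<Rightarrow> 'k" where "p = (\<lambda>_. b)"
  have e_inj: "e k = e l \<longleftrightarrow> k = l" for k l
  proof
    assume "e k = e l"
    then have "e k 0 = e l 0" by simp
    then show "k = l" unfolding e_def by simp
  qed simp
  have e_p: "e k \<noteq> p" for k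
  proof
    assume "e k = p"
    then have "e k 1 = p 1" by simp
    with ab(3) show False unfolding e_def p_def by simp
  qed
  \<comment> \<open>All of \<open>Field \<tau>\<close> is embedded, not just the image of
    \<open>I\<close>: the test space must be infinite even when \<open>I\<close> is finite.\<close>
  define D where "D = insert p (e ` Field \<tau>)"
  have "infinite (e ` Field \<tau>)"
    using \<tau>(2) e_inj by (simp add: finite_image_iff inj_on_def)
  then have D_inf: "infinite D"
    unfolding D_def by simp
  have "|e ` Field \<tau>| \<le>o \<tau>"
    using card_of_image \<tau>_Field ordIso_symmetric ordLeq_ordIso_trans by blast
  moreover have "|{p}| \<le>o \<tau>"
    using \<tau> by (intro finite_ordLeq_infinite_Card_order) simp_all
  ultimately have "|{p} \<union> e ` Field \<tau>| \<le>o \<tau>"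
    using \<tau> by (intro card_of_Un_ordLeq_infinite_Field) auto
  then have D_weight: "weight (discrete_topology D) \<le>o \<tau>"
    by (intro weight_discrete_topology_ordLeq) (simp add: D_def)
  define g where "g i = e (f i)" for i
  have g_D: "g i \<in> D" if "i \<in> I" for i
    using f(2) that unfolding g_def D_def by blast
  have g_inj: "inj_on g I"
    using f(1) unfolding g_def inj_on_def e_inj by blast
  have g_p: "g i \<noteq> p" for i
    unfolding g_def by (rule e_p)
  define \<theta> :: "'a \<Rightarrow> (nat \<Rightarrow> 'k) set" where "\<theta> x = {p}" for x
  define \<Phi> where "\<Phi> x = insert p (g ` {i \<in> I. x \<in> U i})" for x
  have "lsc X (discrete_topology D) \<Phi>"
    unfolding lsc_def
  proof (intro allI impI)
    fix S
    \<comment> \<open>The point \<open>p\<close> belongs to every value; without it,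
      \<open>S\<close> is met exactly on the \<open>U i\<close> with
      \<open>g i \<in> S\<close>.\<close>
    have "{x \<in> topspace X. \<Phi> x \<inter> S \<noteq> {}} =
        (if p \<in> S then topspace X else \<Union>(U ` {i \<in> I. g i \<in> S}))"
      using U(1) openin_subset unfolding \<Phi>_def by auto
    moreover have "openin X (\<Union>(U ` {i \<in> I. g i \<in> S}))"
      using U(1) by (intro openin_Union) auto
    ultimately show "openin X {x \<in> topspace X. \<Phi> x \<inter> S \<noteq> {}}"
      by simp
  qed
  moreover have "\<Phi> \<in> topspace X \<rightarrow> nonempty_closed_sets (discrete_topology D)"
    using g_D unfolding \<Phi>_def nonempty_closed_sets_def by (auto simp: D_def)
  moreover have "\<theta> \<in> topspace X \<rightarrow> nonempty_compact_sets (discrete_topology D)"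
    unfolding \<theta>_def nonempty_compact_sets_def by (auto simp: D_def compactin_discrete_topology)
  moreover have "usc X (discrete_topology D) \<theta>"
    unfolding usc_def
  proof (intro allI impI)
    fix A :: "(nat \<Rightarrow> 'k) set"
    have "{x \<in> topspace X. \<theta> x \<inter> A \<noteq> {}} = (if p \<in> A then topspace X else {})"
      unfolding \<theta>_def by auto
    then show "closedin X {x \<in> topspace X. \<theta> x \<inter> A \<noteq> {}}"
      by simp
  qed
  moreover have "svm_less X \<theta> \<Phi>"
    unfolding svm_less_def svm_le_def
  proof (intro conjI ballI)
    fix x assume x: "x \<in> topspace X"
    show "\<theta> x \<subseteq> \<Phi> x"
      unfolding \<theta>_def \<Phi>_def by blast
    obtain i where "i \<in> I" "x \<in> U i"
      using x U(2) by blast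
    then show "\<Phi> x - \<theta> x \<noteq> {}"
      using g_p[of i] unfolding \<theta>_def \<Phi>_def by blast
  qed
  moreover have "infinite (topspace (discrete_topology D))"
    using D_inf by simp
  moreover note D_weight completely_metrizable_space_discrete_topology[of D]
  ultimately have "\<exists>\<psi>. \<psi> \<in> topspace X \<rightarrow> nonempty_compact_sets (discrete_topology D) \<and>
      usc X (discrete_topology D) \<psi> \<and> svm_less X \<theta> \<psi> \<and> svm_le X \<psi> \<Phi>"
    using ext[unfolded strict_usc_extension_def, rule_format, of "discrete_topology D" \<Phi> \<theta>]
    by blast
  then obtain \<psi> where \<psi>: "\<psi> \<in> topspace X \<rightarrow> nonempty_compact_sets (discrete_topology D)"
      "usc X (discrete_topology D) \<psi>" "svm_less X \<theta> \<psi>" "svm_le X \<psi> \<Phi>"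
    by blast
  \<comment> \<open>Pulling back along the injective \<open>g\<close> discards \<open>p\<close>.
    Compact subsets of a discrete space are finite and all its subsets are closed, hence the
    finiteness of \<open>\<phi> x\<close> and the arbitrary \<open>J\<close>.\<close>
  define \<phi> where "\<phi> x = {i \<in> I. g i \<in> \<psi> x}" for x
  show ?thesis
  proof
    fix x assume x: "x \<in> topspace X"
    have \<psi>x: "finite (\<psi> x)" "\<psi> x \<subseteq> \<Phi> x" "\<psi> x - {p} \<noteq> {}"
      using \<psi> x unfolding nonempty_compact_sets_def svm_less_def svm_le_def \<theta>_def
      by (auto simp: compactin_discrete_topology)
    have "inj_on g (\<phi> x)" "g ` \<phi> x \<subseteq> \<psi> x"
      using g_inj unfolding \<phi>_def by (auto intro: inj_on_subset)
    then show "finite (\<phi> x)"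
      using \<psi>x(1) inj_on_finite by blast
    obtain y where "y \<in> \<psi> x" "y \<noteq> p"
      using \<psi>x(3) by blast
    then obtain i where "i \<in> I" "y = g i"
      using \<psi>x(2) unfolding \<Phi>_def by blast
    then show "\<phi> x \<noteq> {}"
      using \<open>y \<in> \<psi> x\<close> unfolding \<phi>_def by blast
    show "\<phi> x \<subseteq> {i \<in> I. x \<in> U i}"
    proof
      fix i assume i: "i \<in> \<phi> x"
      then have "g i \<in> g ` {j \<in> I. x \<in> U j}"
        using \<psi>x(2) g_p[of i] unfolding \<phi>_def \<Phi>_def by blast
      then show "i \<in> {i \<in> I. x \<in> U i}"
        using i inj_onD[OF g_inj] unfolding \<phi>_def by blast
    qed
  next
    fix J
    have "closedin (discrete_topology D) (g ` (I \<inter> J))"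
      using g_D by auto
    then have "closedin X {x \<in> topspace X. \<psi> x \<inter> g ` (I \<inter> J) \<noteq> {}}"
      using \<psi>(2) unfolding usc_def by blast
    moreover have "\<psi> x \<inter> g ` (I \<inter> J) \<noteq> {} \<longleftrightarrow> \<phi> x \<inter> J \<noteq> {}" for x
      unfolding \<phi>_def by blast
    ultimately show "closedin X {x \<in> topspace X. \<phi> x \<inter> J \<noteq> {}}"
      by simp
  qed
qed

text \<open>In its dual form normality asks to shrink a two-set open cover to a closed one. A finite
  selection for the cover indexed by \<open>bool\<close> supplies it: the closed sets are those
  where the selection contains \<open>True\<close>, respectively \<open>False\<close>.\<close>

lemma strict_usc_extension_imp_normal_space:
  fixes \<tau> :: "'k rel"
  assumes \<tau>: "Card_order \<tau>" "infinite (Field \<tau>)"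
    and ext: "strict_usc_extension \<tau> X TYPE(nat \<Rightarrow> 'k)"
  shows "normal_space X"
  unfolding normal_space_dual
proof (intro allI impI, elim conjE)
  fix U V assume U: "openin X U" and V: "openin X V" and UV: "U \<union> V = topspace X"
  define W where "W i = (if i then U else V)" for i
  have card: "|UNIV :: bool set| \<le>o \<tau>"
    using \<tau> by (intro finite_ordLeq_infinite_Card_order) simp_all
  have W_open: "openin X (W i)" for i
    using U V unfolding W_def by simp
  have W_cover: "topspace X \<subseteq> (\<Union>i. W i)"
    using UV unfolding W_def by (auto simp: UNIV_bool)
  obtain \<phi> where \<phi>: "\<And>x. x \<in> topspace X \<Longrightarrow> finite (\<phi> x)" "\<And>x. x \<in> topspace X \<Longrightarrow> \<phi> x \<noteq> {}"
      "\<And>x. x \<in> topspace X \<Longrightarrow> \<phi> x \<subseteq> {i \<in> UNIV. x \<in> W i}"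
      "\<And>J. closedin X {x \<in> topspace X. \<phi> x \<inter> J \<noteq> {}}"
    by (rule strict_usc_extension_finite_selection[OF \<tau> ext card W_open W_cover]) (rule that)
  define A where "A J = {x \<in> topspace X. \<phi> x \<inter> J \<noteq> {}}" for J
  have "closedin X (A {True})" "closedin X (A {False})"
    using \<phi>(4) unfolding A_def by blast+
  moreover have "A {True} \<subseteq> U" "A {False} \<subseteq> V"
    using \<phi>(3) unfolding A_def W_def by fastforce+
  moreover have "A {True} \<union> A {False} = topspace X"
  proof -
    have "\<phi> x \<inter> {True} \<noteq> {} \<or> \<phi> x \<inter> {False} \<noteq> {}" if x: "x \<in> topspace X" for x
    proof -
      obtain i where "i \<in> \<phi> x"
        using \<phi>(2)[OF x] by blast
      then show ?thesis
        by (cases i) auto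
    qed
    then show ?thesis
      unfolding A_def by blast
  qed
  ultimately show "\<exists>S T. closedin X S \<and> closedin X T \<and> S \<subseteq> U \<and> T \<subseteq> V \<and> S \<union> T = topspace X"
    by blast
qed

text \<open>
  Michael's passage from closed to open refinements: the closed sets \<open>{x. U \<in> \<phi> x}\<close> refine
  the cover. A second finite selection \<open>\<rho>\<close>, for the cover by the open sets on which
  \<open>\<phi>\<close> stays inside a fixed finite set, tells how far they may be enlarged.
\<close>

lemma strict_usc_extension_imp_tau_paracompact:
  fixes \<tau> :: "'k rel"
  assumes \<tau>: "Card_order \<tau>" "infinite (Field \<tau>)"
    and ext: "strict_usc_extension \<tau> X TYPE(nat \<Rightarrow> 'k)"
  shows "tau_paracompact \<tau> X"
  unfolding tau_paracompact_def
proof (intro allI impI, elim conjE)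
  fix \<U> assume \<U>: "\<forall>U\<in>\<U>. openin X U" "\<Union>\<U> = topspace X" "|\<U>| \<le>o \<tau>"
  obtain \<phi> where \<phi>: "\<And>x. x \<in> topspace X \<Longrightarrow> finite (\<phi> x)" "\<And>x. x \<in> topspace X \<Longrightarrow> \<phi> x \<noteq> {}"
      "\<And>x. x \<in> topspace X \<Longrightarrow> \<phi> x \<subseteq> {U \<in> \<U>. x \<in> U}"
      "\<And>J. closedin X {x \<in> topspace X. \<phi> x \<inter> J \<noteq> {}}"
    by (rule strict_usc_extension_finite_selection[OF \<tau> ext \<U>(3), of "\<lambda>U. U"])
      (use \<U> in \<open>auto\<close>)
  define G where "G S = {x \<in> topspace X. \<phi> x \<subseteq> S}" for S
  have G_open: "openin X (G S)" for S
  proof -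
    have "G S = topspace X - {x \<in> topspace X. \<phi> x \<inter> - S \<noteq> {}}"
      unfolding G_def by blast
    then show ?thesis
      using openin_diff[OF openin_topspace \<phi>(4)[of "- S"]] by simp
  qed
  have G_cover: "topspace X \<subseteq> (\<Union>S\<in>Fpow \<U>. G S)"
  proof
    fix x assume x: "x \<in> topspace X"
    then have "\<phi> x \<in> Fpow \<U>"
      using \<phi>(1,3) unfolding Fpow_def by blast
    then show "x \<in> (\<Union>S\<in>Fpow \<U>. G S)"
      using x unfolding G_def by blast
  qed
  obtain \<rho> where \<rho>: "\<And>x. x \<in> topspace X \<Longrightarrow> finite (\<rho> x)" "\<And>x. x \<in> topspace X \<Longrightarrow> \<rho> x \<noteq> {}"
      "\<And>x. x \<in> topspace X \<Longrightarrow> \<rho> x \<subseteq> {S \<in> Fpow \<U>. x \<in> G S}"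
      "\<And>J. closedin X {x \<in> topspace X. \<rho> x \<inter> J \<noteq> {}}"
    by (rule strict_usc_extension_finite_selection[OF \<tau> ext Fpow_ordLeq_infinite_Card_order[OF \<U>(3) \<tau>] G_open G_cover])
      (rule that)
  \<comment> \<open>If \<open>U \<in> \<phi> x\<close>, each \<open>S \<in> \<rho> x\<close>
    contains \<open>\<phi> x\<close> and hence \<open>U\<close>. So \<open>V U\<close> contains the
    closed set of points selecting \<open>U\<close>, and the sets \<open>V U\<close> still
    cover.\<close>
  define V where "V U = U \<inter> {x \<in> topspace X. \<rho> x \<subseteq> {S. U \<in> S}}" for U
  have V_open: "openin X (V U)" if "U \<in> \<U>" for U
  proof -
    have "{x \<in> topspace X. \<rho> x \<subseteq> {S. U \<in> S}} = topspace X - {x \<in> topspace X. \<rho> x \<inter> {S. U \<notin> S} \<noteq> {}}"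
      by blast
    then have "openin X {x \<in> topspace X. \<rho> x \<subseteq> {S. U \<in> S}}"
      using openin_diff[OF openin_topspace \<rho>(4)[of "{S. U \<notin> S}"]] by simp
    then show ?thesis
      using \<U>(1) that unfolding V_def by (simp add: openin_Int)
  qed
  show "\<exists>\<V>. (\<forall>V\<in>\<V>. openin X V) \<and> \<Union>\<V> = topspace X \<and> (\<forall>V\<in>\<V>. \<exists>U\<in>\<U>. V \<subseteq> U) \<and> locally_finite_in X \<V>"
  proof (intro exI conjI)
    show "\<forall>T\<in>V ` \<U>. openin X T"
      using V_open by blast
    show "\<forall>T\<in>V ` \<U>. \<exists>U\<in>\<U>. T \<subseteq> U"
      unfolding V_def by blast
    show cov: "\<Union>(V ` \<U>) = topspace X"
    proof
      show "\<Union>(V ` \<U>) \<subseteq> topspace X"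
        unfolding V_def by blast
      show "topspace X \<subseteq> \<Union>(V ` \<U>)"
      proof
        fix x assume x: "x \<in> topspace X"
        obtain U where U: "U \<in> \<phi> x"
          using \<phi>(2)[OF x] by blast
        then have "U \<in> \<U>" "x \<in> U"
          using \<phi>(3)[OF x] by blast+
        moreover have "\<rho> x \<subseteq> {S. U \<in> S}"
          using \<rho>(3)[OF x] U unfolding G_def by blast
        ultimately show "x \<in> \<Union>(V ` \<U>)"
          using x unfolding V_def by blast
      qed
    qed
    show "locally_finite_in X (V ` \<U>)"
      unfolding locally_finite_in_def
    proof (intro conjI ballI)
      show "\<Union>(V ` \<U>) \<subseteq> topspace X"
        using cov by simp
      fix x assume x: "x \<in> topspace X"
      \<comment> \<open>On \<open>?N\<close> the values of \<open>\<rho>\<close> stay inside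
        \<open>\<rho> x\<close>. If \<open>V U\<close> meets \<open>?N\<close> at \<open>z\<close>,
        any member of the nonempty \<open>\<rho> z\<close> contains \<open>U\<close>, so
        \<open>U\<close> belongs to the finite set \<open>\<Union>(\<rho> x)\<close>.\<close>
      let ?N = "topspace X - {x' \<in> topspace X. \<rho> x' \<inter> - \<rho> x \<noteq> {}}"
      have "openin X ?N"
        using \<rho>(4) by blast
      moreover have "x \<in> ?N"
        using x by blast
      moreover have "finite {T \<in> V ` \<U>. T \<inter> ?N \<noteq> {}}"
      proof (rule finite_subset)
        show "{T \<in> V ` \<U>. T \<inter> ?N \<noteq> {}} \<subseteq> V ` \<Union>(\<rho> x)"
        proof
          fix T assume "T \<in> {T \<in> V ` \<U>. T \<inter> ?N \<noteq> {}}"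
          then obtain U z where U: "T = V U" "z \<in> V U" "z \<in> ?N"
            by blast
          then have z: "z \<in> topspace X" "\<rho> z \<subseteq> \<rho> x" "\<rho> z \<subseteq> {S. U \<in> S}"
            unfolding V_def by blast+
          then obtain S where "S \<in> \<rho> z"
            using \<rho>(2) by blast
          then have "U \<in> \<Union>(\<rho> x)"
            using z by blast
          then show "T \<in> V ` \<Union>(\<rho> x)"
            using U(1) by blast
        qed
        have "\<forall>S\<in>\<rho> x. finite S"
          using \<rho>(3)[OF x] unfolding Fpow_def by blast
        then show "finite (V ` \<Union>(\<rho> x))"
          using \<rho>(1)[OF x] by blast
      qed
      ultimately show "\<exists>N. openin X N \<and> x \<in> N \<and> finite {T \<in> V ` \<U>. T \<inter> N \<noteq> {}}"
        by blast
    qed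
  qed
qed

text \<open>The backward implication tests the property only on a discrete space built inside
  \<open>nat \<Rightarrow> 'k\<close>, so this type suffices for the equivalence. The forward
  argument works over any type of points, which the second conjunct records.\<close>

theorem proposition3p5:
  fixes \<tau> :: "'k rel" and X :: "'a topology"
  assumes "Card_order \<tau>" and "infinite (Field \<tau>)"
    and "Hausdorff_space X" and "infinite (topspace X)"
  shows "(normal_space X \<and> tau_paracompact \<tau> X \<longleftrightarrow>
            strict_usc_extension \<tau> X TYPE(nat \<Rightarrow> 'k)) \<and>
         (normal_space X \<and> tau_paracompact \<tau> X \<longrightarrow>
            strict_usc_extension \<tau> X TYPE('b))"
proof (intro conjI iffI impI)
  assume X: "normal_space X \<and> tau_paracompact \<tau> X"
  show "strict_usc_extension \<tau> X TYPE(nat \<Rightarrow> 'k)"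
    using assms(1,2) X by (intro strict_usc_extension_if_tau_paracompact) auto
  show "strict_usc_extension \<tau> X TYPE('b)"
    using assms(1,2) X by (intro strict_usc_extension_if_tau_paracompact) auto
next
  assume "strict_usc_extension \<tau> X TYPE(nat \<Rightarrow> 'k)"
  then show "normal_space X" "tau_paracompact \<tau> X"
    by (rule strict_usc_extension_imp_normal_space[OF assms(1,2)]
        strict_usc_extension_imp_tau_paracompact[OF assms(1,2)])+
qed

end
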